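(* A $C^2$-smooth strongly pseudoconvex domain $D\subset\mathbb{C}^n$ cannot be the union of an increasing sequence of open subsets $D_j$, each of which is biholomorphic to the symmetrized polydisc $\mathbb{G}_n$.
   Context: The symmetrized polydisc is $\mathbb{G}_n=\pi(\Delta^n)$, where $\Delta\subset\mathbb{C}$ is the unit disc, $\Delta^n$ is the unit polydisc in $\mathbb{C}^n$, and $\pi:\mathbb{C}^n\to\mathbb{C}^n$ is the symmetrization map whose $k$-th component is the $k$-th elementary symmetric polynomial $\sum_{1\le j_1<\dots<j_k\le n}z_{j_1}\cdots z_{j_k}$, $1\le k\le n$.
   Formalization: The dimension is assumed to be n ≥ 2 (for n = 1 the disc is itself G_1, so the claim fails), and a strongly pseudoconvex domain is taken to be bounded, as usual (otherwise C^n, with empty boundary, would be a counterexample). *)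

theory Defs
  imports "HOL-Analysis.Analysis"
begin

section \<open>Holomorphic maps and biholomorphic open sets in several complex variables\<close>

definition holomorphic_map_on ::
    "(complex ^ 'n::finite \<Rightarrow> complex ^ 'm::finite) \<Rightarrow> (complex ^ 'n) set \<Rightarrow> bool" where
  "holomorphic_map_on F U \<longleftrightarrow>
     (\<forall>z\<in>U. \<exists>L. (F has_derivative L) (at z) \<and> (\<forall>c v. L (c *s v) = c *s L v))"

definition biholomorphic :: "(complex ^ 'n::finite) set \<Rightarrow> (complex ^ 'm::finite) set \<Rightarrow> bool" where
  "biholomorphic U V \<longleftrightarrow> open U \<and> open V \<and>
     (\<exists>F G. holomorphic_map_on F U \<and> holomorphic_map_on G V \<and>
            F ` U = V \<and> G ` V = U \<and> (\<forall>z\<in>U. G (F z) = z) \<and> (\<forall>w\<in>V. F (G w) = w))"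

section \<open>The symmetrized polydisc\<close>

definition unit_polydisc :: "(complex ^ 'n::finite) set" where
  "unit_polydisc = {z. \<forall>i. norm (z $ i) < 1}"

text \<open>A \<open>k\<close>-element set of indices stands for the tuple \<open>j\<^sub>1 < \<dots> < j\<^sub>k\<close>.\<close>

definition elem_sym :: "nat \<Rightarrow> complex ^ 'n::finite \<Rightarrow> complex" where
  "elem_sym k z = (\<Sum>J | card J = k. \<Prod>j\<in>J. z $ j)"

text \<open>
  The index type is linearly ordered, so that its elements can be counted off as
  \<open>1, \<dots>, n\<close>: the index \<open>i\<close> has number \<open>card {..i}\<close>.
\<close>

definition symmetrization :: "complex ^ 'n::{finite,linorder} \<Rightarrow> complex ^ 'n::{finite,linorder}" where
  "symmetrization z = (\<chi> i. elem_sym (card {..i}) z)"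

definition symmetrized_polydisc :: "(complex ^ 'n::{finite,linorder}) set" where
  "symmetrized_polydisc = symmetrization ` unit_polydisc"

section \<open>Strongly pseudoconvex domains\<close>

definition C2_on :: "('a::real_normed_vector \<Rightarrow> real) \<Rightarrow> 'a set \<Rightarrow> bool" where
  "C2_on f U \<longleftrightarrow>
     (\<exists>(f' :: 'a \<Rightarrow> 'a \<Rightarrow>\<^sub>L real) (f'' :: 'a \<Rightarrow> 'a \<Rightarrow>\<^sub>L 'a \<Rightarrow>\<^sub>L real).
        (\<forall>z\<in>U. (f has_derivative blinfun_apply (f' z)) (at z)) \<and>
        (\<forall>z\<in>U. (f' has_derivative blinfun_apply (f'' z)) (at z)) \<and>
        continuous_on U f'')"

text \<open>
  The Wirtinger derivatives \<open>\<partial>/\<partial>z\<^sub>j = (\<partial>/\<partial>x\<^sub>j - \<i> \<partial>/\<partial>y\<^sub>j) / 2\<close> and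
  \<open>\<partial>/\<partial>\<zeta>\<^sub>j = (\<partial>/\<partial>x\<^sub>j + \<i> \<partial>/\<partial>y\<^sub>j) / 2\<close>, where \<open>z\<^sub>j = x\<^sub>j + \<i> y\<^sub>j\<close> and \<open>\<zeta>\<^sub>j\<close> is the
  conjugate of \<open>z\<^sub>j\<close>.
\<close>

definition wirtinger ::
    "'n::finite \<Rightarrow> (complex ^ 'n \<Rightarrow> complex) \<Rightarrow> complex ^ 'n \<Rightarrow> complex" where
  "wirtinger j f z =
     (frechet_derivative f (at z) (axis j 1) - \<i> * frechet_derivative f (at z) (axis j \<i>)) / 2"

definition wirtinger_cnj ::
    "'n::finite \<Rightarrow> (complex ^ 'n \<Rightarrow> complex) \<Rightarrow> complex ^ 'n \<Rightarrow> complex" where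
  "wirtinger_cnj j f z =
     (frechet_derivative f (at z) (axis j 1) + \<i> * frechet_derivative f (at z) (axis j \<i>)) / 2"

definition complex_tangent_space ::
    "(complex ^ 'n::finite \<Rightarrow> real) \<Rightarrow> complex ^ 'n \<Rightarrow> (complex ^ 'n) set" where
  "complex_tangent_space r p =
     {w. (\<Sum>j\<in>UNIV. wirtinger j (\<lambda>z. complex_of_real (r z)) p * w $ j) = 0}"

text \<open>For \<open>r\<close> of class \<open>C\<^sup>2\<close> the double sum is real, so taking \<open>Re\<close> only adjusts the type.\<close>

definition levi_form ::
    "(complex ^ 'n::finite \<Rightarrow> real) \<Rightarrow> complex ^ 'n \<Rightarrow> complex ^ 'n \<Rightarrow> real" where
  "levi_form r p w =
     Re (\<Sum>j\<in>UNIV. \<Sum>k\<in>UNIV.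
           wirtinger j (wirtinger_cnj k (\<lambda>z. complex_of_real (r z))) p * w $ j * cnj (w $ k))"

definition C2_defining_function_at ::
    "'a::real_normed_vector set \<Rightarrow> 'a \<Rightarrow> 'a set \<Rightarrow> ('a \<Rightarrow> real) \<Rightarrow> bool" where
  "C2_defining_function_at D p U r \<longleftrightarrow>
     open U \<and> p \<in> U \<and> C2_on r U \<and> D \<inter> U = {z\<in>U. r z < 0} \<and>
     (\<forall>z\<in>U. frechet_derivative r (at z) \<noteq> (\<lambda>v. 0))"

text \<open>
  As usual, boundedness is part of the notion. (If it were dropped, the whole space, whose
  boundary is empty, would qualify.)
\<close>

definition C2_strongly_pseudoconvex_domain :: "(complex ^ 'n::finite) set \<Rightarrow> bool" where
  "C2_strongly_pseudoconvex_domain D \<longleftrightarrow>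
     open D \<and> connected D \<and> D \<noteq> {} \<and> bounded D \<and>
     (\<forall>p\<in>frontier D. \<exists>U r. C2_defining_function_at D p U r \<and>
        (\<forall>w\<in>complex_tangent_space r p. w \<noteq> 0 \<longrightarrow> levi_form r p w > 0))"

end

theory Submission
  imports Defs "HOL-Complex_Analysis.Riemann_Mapping"
begin

text \<open>
  The argument is that of Remmert and Stein for the non-existence of proper maps from a product
  to a strongly pseudoconvex domain, made quantitative so that no limit of the maps is needed.
  Let \<open>G\<^sub>j\<close> map the symmetrized polydisc onto \<open>E\<^sub>j\<close>, and put \<open>f = G\<^sub>j \<circ> \<pi>\<close> on the polydisc and
  \<open>f a = q\<close> for a fixed \<open>q \<in> D\<close>. The boundary of \<open>D\<close> contains no analytic discs, so by Montel's
  theorem discs in \<open>D\<close> that avoid a large compact \<open>K\<close> are almost constant. Blaschke products in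
  the coordinates descend to the symmetrized polydisc; the one vanishing at \<open>z\<^sub>l\<close>, together
  with a Harnack inequality on \<open>E\<^sub>j\<close> that is uniform in \<open>j\<close>, shows that \<open>f z \<notin> K\<close> once
  some \<open>\<bar>z\<^sub>l\<bar>\<close> is close to \<open>1\<close>. Hence \<open>f\<close> is almost constant in \<open>z\<^sub>k\<close> when \<open>\<bar>z\<^sub>l\<bar>\<close> is close to
  \<open>1\<close>, where \<open>l \<noteq> k\<close>, and then, by the maximum principle in \<open>z\<^sub>l\<close>, everywhere. So all coordinates
  of \<open>a\<close> can be moved a definite hyperbolic distance away from one of them, say \<open>c\<close>, while \<open>f\<close>
  hardly moves. But the Blaschke product with factors vanishing at \<open>c\<close> increases from \<open>0\<close> to at
  least \<open>2\<^sup>-\<^sup>n\<close>, which contradicts the Schwarz lemma on a ball around \<open>q\<close>.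
\<close>

section \<open>Holomorphic curves\<close>

lemma has_derivative_curve:
  fixes f :: "complex \<Rightarrow> complex ^ 'n::finite"
  assumes "\<And>i. ((\<lambda>t. f t $ i) has_field_derivative w $ i) (at z)"
  shows "(f has_derivative (\<lambda>h. h *s w)) (at z)"
proof (subst has_derivative_componentwise_within, intro ballI)
  fix b :: "complex ^ 'n" assume "b \<in> Basis"
  then obtain i u where b: "b = axis i u" by (auto simp: Basis_vec_def)
  have "((\<lambda>t. f t $ i \<bullet> u) has_derivative (\<lambda>h. (w $ i * h) \<bullet> u)) (at z)"
    using assms[of i, unfolded has_field_derivative_def]
    by (rule has_derivative_inner_left)
  then show "((\<lambda>x. f x \<bullet> b) has_derivative (\<lambda>x. (x *s w) \<bullet> b)) (at z)"
    by (simp add: b inner_axis mult.commute)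
qed

text \<open>By the chain rule the derivative of the composite is multiplication by a vector
  \<open>L w\<close>, because \<open>L\<close> is complex linear. Maps of several variables are
  studied below through such curves, to which Montel, Schwarz and the maximum principle
  apply.\<close>

lemma holomorphic_map_on_curve:
  fixes \<gamma> :: "complex \<Rightarrow> complex ^ 'n::finite" and F :: "complex ^ 'n \<Rightarrow> complex ^ 'm::finite"
  assumes F: "holomorphic_map_on F U" and S: "open S" "\<gamma> ` S \<subseteq> U"
    and \<gamma>: "\<And>i. (\<lambda>t. \<gamma> t $ i) holomorphic_on S"
  shows "(\<lambda>t. F (\<gamma> t) $ i) holomorphic_on S"
proof -
  have "(\<lambda>t. F (\<gamma> t) $ i) field_differentiable at z" if "z \<in> S" for z
  proof -
    define w where "w = (\<chi> i. deriv (\<lambda>t. \<gamma> t $ i) z)"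
    have 1: "(\<gamma> has_derivative (\<lambda>h. h *s w)) (at z)"
    proof (rule has_derivative_curve)
      fix i show "((\<lambda>t. \<gamma> t $ i) has_field_derivative w $ i) (at z)"
        unfolding w_def vec_lambda_beta by (rule holomorphic_derivI[OF \<gamma> S(1) that])
    qed
    have "\<gamma> z \<in> U" using S(2) that by (simp add: image_subset_iff)
    then obtain L where L: "(F has_derivative L) (at (\<gamma> z))" "\<forall>c v. L (c *s v) = c *s L v"
      using F[unfolded holomorphic_map_on_def] by metis
    have "((\<lambda>t. F (\<gamma> t)) has_derivative (\<lambda>h. h *s L w)) (at z)"
      using has_derivative_compose[OF 1 L(1)] by (simp add: L(2))
    then have "((\<lambda>t. F (\<gamma> t) $ i) has_derivative (\<lambda>h. (h *s L w) $ i)) (at z)"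
      by (rule bounded_linear.has_derivative[OF bounded_linear_vec_nth])
    moreover have "(\<lambda>h. (h *s L w) $ i) = (*) (L w $ i)"
      by (simp add: fun_eq_iff mult.commute)
    ultimately have "((\<lambda>t. F (\<gamma> t) $ i) has_field_derivative L w $ i) (at z)"
      unfolding has_field_derivative_def by metis
    then show ?thesis using field_differentiable_def by blast
  qed
  then show ?thesis
    using S(1) by (auto simp: holomorphic_on_open field_differentiable_def)
qed

section \<open>The Levi form and analytic discs in the boundary\<close>

lemma ii_scale_axis: "\<i> *s (axis j 1 :: complex ^ 'n::finite) = axis j \<i>"
  by (simp add: vec_eq_iff axis_def)

lemma ii_scale_ii_scale: "\<i> *s (\<i> *s v) = - (v :: complex ^ 'n::finite)"
  by (simp add: vec_eq_iff)

text \<open>A real-linear map that commutes with multiplication by \<open>\<i>\<close> is complex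
  linear, so it is determined by its values on the standard basis.\<close>

lemma complex_linear_expansion:
  fixes H :: "complex ^ 'n::finite \<Rightarrow> complex"
  assumes lin: "linear H" and im: "\<And>v. H (\<i> *s v) = \<i> * H v"
  shows "(\<Sum>j\<in>UNIV. w $ j * H (axis j 1)) = H w"
proof -
  have sc: "H (c *s v) = c * H v" for c v
  proof -
    have "c *s v = Re c *\<^sub>R v + Im c *\<^sub>R (\<i> *s v)"
      by (simp add: vec_eq_iff complex_eq_iff)
    then have "H (c *s v) = (of_real (Re c) + \<i> * of_real (Im c)) * H v"
      by (simp add: linear_add[OF lin] linear_scale[OF lin] im scaleR_conv_of_real[where 'a = complex] algebra_simps)
    then show ?thesis by (simp flip: complex_eq)
  qed
  have "(\<Sum>j\<in>UNIV. w $ j *s axis j 1) = w"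
    by (simp add: vec_eq_iff axis_def if_distrib cong: if_cong)
  then have "H w = H (\<Sum>j\<in>UNIV. w $ j *s axis j 1)" by simp
  also have "\<dots> = (\<Sum>j\<in>UNIV. w $ j * H (axis j 1))"
    by (simp add: linear_sum[OF lin] sc)
  finally show ?thesis by simp
qed

text \<open>The right-hand side is the complex-linear part of the real derivative \<open>r'\<close>,
  and its values on the standard basis are the Wirtinger derivatives. Its vanishing at
  \<open>w\<close> means that \<open>r'\<close> kills both \<open>w\<close> and
  \<open>\<i> *s w\<close>.\<close>

lemma sum_wirtinger:
  fixes r :: "complex ^ 'n::finite \<Rightarrow> real"
  assumes r: "(r has_derivative r') (at p)"
  shows "(\<Sum>j\<in>UNIV. wirtinger j (\<lambda>z. complex_of_real (r z)) p * w $ j)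
       = (of_real (r' w) - \<i> * of_real (r' (\<i> *s w))) / 2"
proof -
  have lin: "linear r'" using r has_derivative_linear by blast
  have fd: "frechet_derivative (\<lambda>z. complex_of_real (r z)) (at p) = (\<lambda>v. of_real (r' v))"
    by (rule frechet_derivative_at[symmetric, OF has_derivative_of_real[OF r]])
  define H where "H v = (complex_of_real (r' v) - \<i> * of_real (r' (\<i> *s v))) / 2" for v
  have "linear H"
  proof
    fix u v :: "complex ^ 'n" and t :: real
    have "\<i> *s (t *\<^sub>R v) = t *\<^sub>R (\<i> *s v)" by (simp add: vec_eq_iff)
    then show "H (t *\<^sub>R v) = t *\<^sub>R H v"
      by (simp add: H_def linear_scale[OF lin] scaleR_conv_of_real[where 'a = complex] algebra_simps)
    show "H (u + v) = H u + H v"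
      by (simp add: H_def linear_add[OF lin] algebra_simps vector_add_ldistrib add_divide_distrib diff_divide_distrib)
  qed
  moreover have "H (\<i> *s v) = \<i> * H v" for v
    by (simp add: H_def ii_scale_ii_scale linear_neg[OF lin] algebra_simps)
  ultimately have "(\<Sum>j\<in>UNIV. w $ j * H (axis j 1)) = H w"
    by (rule complex_linear_expansion)
  then show ?thesis
    by (simp add: H_def wirtinger_def fd ii_scale_axis mult.commute)
qed

text \<open>The right-hand side is a quarter of the Laplacian of \<open>r\<close> along the complex
  line through \<open>p\<close> in direction \<open>w\<close>, a form that can be compared with
  second derivatives along a holomorphic curve. The Wirtinger coefficients are, up to the factor
  1/4, the entries of a sesquilinear form built from \<open>B\<close>, and expanding in both slots
  recovers its value at \<open>w\<close>.\<close>

lemma levi_form_eq: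
  fixes r :: "complex ^ 'n::finite \<Rightarrow> real"
  assumes U: "open U" "p \<in> U"
    and r: "\<And>z. z \<in> U \<Longrightarrow> (r has_derivative blinfun_apply (r' z)) (at z)"
    and r': "(r' has_derivative blinfun_apply B) (at p)"
  shows "levi_form r p w = (B w w + B (\<i> *s w) (\<i> *s w)) / 4"
proof -
  have wc: "wirtinger_cnj k (\<lambda>z. complex_of_real (r z)) z
          = (of_real (r' z (axis k 1)) + \<i> * of_real (r' z (axis k \<i>))) / 2" if "z \<in> U" for k z
    unfolding wirtinger_cnj_def
      frechet_derivative_at[symmetric, OF has_derivative_of_real[OF r[OF that]]] by simp
  have d: "((\<lambda>z. r' z v) has_derivative (\<lambda>u. B u v)) (at p)" for v
    by (rule bounded_linear.has_derivative[OF blinfun.bounded_linear_left r'])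
  have wwc: "frechet_derivative (wirtinger_cnj k (\<lambda>z. complex_of_real (r z))) (at p)
       = (\<lambda>u. (of_real (B u (axis k 1)) + \<i> * of_real (B u (axis k \<i>))) / 2)" for k
  proof (rule frechet_derivative_at[symmetric])
    have "((\<lambda>z. (complex_of_real (r' z (axis k 1)) + \<i> * of_real (r' z (axis k \<i>))) / 2)
       has_derivative (\<lambda>u. (of_real (B u (axis k 1)) + \<i> * of_real (B u (axis k \<i>))) / 2)) (at p)"
      by (rule derivative_eq_intros has_derivative_of_real d refl | simp)+
    then show "(wirtinger_cnj k (\<lambda>z. complex_of_real (r z)) has_derivative
       (\<lambda>u. (of_real (B u (axis k 1)) + \<i> * of_real (B u (axis k \<i>))) / 2)) (at p)"
      by (rule has_derivative_transform_within_open[OF _ U]) (simp add: wc)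
  qed
  have iR: "\<i> *s (t *\<^sub>R v) = t *\<^sub>R (\<i> *s v)" for t and v :: "complex ^ 'n" by (simp add: vec_eq_iff)
  \<comment> \<open>\<open>H\<close> is sesquilinear even if \<open>B\<close> is not symmetric, and \<open>Re (H w w) = C w w\<close>.\<close>
  define C where "C u v = B u v + B (\<i> *s u) (\<i> *s v)" for u v
  define H where "H u v = complex_of_real (C u v) + \<i> * of_real (C u (\<i> *s v))" for u v
  note bl = blinfun.add_left blinfun.add_right blinfun.scaleR_left blinfun.scaleR_right
    blinfun.minus_left blinfun.minus_right blinfun.diff_left blinfun.diff_right
  have l1: "linear (\<lambda>u. H u v)" for v
    by standard (simp_all add: H_def C_def bl vector_add_ldistrib algebra_simps scaleR_conv_of_real[where 'a = complex] iR)
  \<comment> \<open>\<open>H\<close> is conjugate linear in its second slot, so its conjugate is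
    what \<open>complex_linear_expansion\<close> accepts.\<close>
  have l2: "linear (\<lambda>v. cnj (H u v))" for u
    by standard (simp_all add: H_def C_def bl vector_add_ldistrib algebra_simps scaleR_conv_of_real[where 'a = complex] iR)
  have i1: "H (\<i> *s u) v = \<i> * H u v" for u v
    by (simp add: H_def C_def bl ii_scale_ii_scale algebra_simps)
  have i2: "cnj (H u (\<i> *s v)) = \<i> * cnj (H u v)" for u v
    by (simp add: H_def C_def bl ii_scale_ii_scale algebra_simps)
  have coef: "wirtinger j (wirtinger_cnj k (\<lambda>z. complex_of_real (r z))) p = H (axis j 1) (axis k 1) / 4" for j k
    unfolding wirtinger_def wwc
    by (simp add: H_def C_def ii_scale_axis ii_scale_ii_scale bl field_simps
        flip: ii_scale_axis)
  have "(\<Sum>k\<in>UNIV. H u (axis k 1) * cnj (w $ k)) = cnj (\<Sum>k\<in>UNIV. w $ k * cnj (H u (axis k 1)))" for u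
    by (simp add: mult.commute)
  also have "\<dots> u = H u w" for u
    by (subst complex_linear_expansion[OF l2 i2]) simp
  finally have e2: "(\<Sum>k\<in>UNIV. H u (axis k 1) * cnj (w $ k)) = H u w" for u .
  have "(\<Sum>j\<in>UNIV. \<Sum>k\<in>UNIV. wirtinger j (wirtinger_cnj k (\<lambda>z. complex_of_real (r z))) p * w $ j * cnj (w $ k))
     = (\<Sum>j\<in>UNIV. w $ j * (\<Sum>k\<in>UNIV. H (axis j 1) (axis k 1) * cnj (w $ k))) / 4"
    by (simp add: coef sum_distrib_left sum_divide_distrib mult_ac)
  also have "\<dots> = H w w / 4"
    by (simp add: e2 complex_linear_expansion[OF l1 i1])
  finally have "levi_form r p w = Re (H w w / 4)"
    unfolding levi_form_def by (rule arg_cong)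
  then show ?thesis by (simp add: H_def C_def)
qed

text \<open>Since \<open>r \<circ> f\<close> vanishes near \<open>p\<close>, its first derivatives
  show that the velocity of \<open>f\<close> is complex tangential, and its second derivatives show
  that the Levi form vanishes on that velocity. Strong pseudoconvexity then forces the velocity to
  be 0.\<close>

lemma holomorphic_curve_in_frontier:
  fixes f :: "complex \<Rightarrow> complex ^ 'n::finite"
  assumes D: "C2_strongly_pseudoconvex_domain D"
    and S: "open S" "p \<in> S" and fr: "f ` S \<subseteq> frontier D"
    and f: "\<And>i. (\<lambda>t. f t $ i) holomorphic_on S"
  shows "deriv (\<lambda>t. f t $ i) p = 0"
proof -
  obtain U r where def: "C2_defining_function_at D (f p) U r"
    and levi: "\<And>w. w \<in> complex_tangent_space r (f p) \<Longrightarrow> w \<noteq> 0 \<Longrightarrow> levi_form r (f p) w > 0"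
    using D S fr unfolding C2_strongly_pseudoconvex_domain_def by blast
  have U: "open U" "f p \<in> U" "C2_on r U" and "D \<inter> U = {z \<in> U. r z < 0}"
    using def by (simp_all add: C2_defining_function_at_def)
  then have DU: "z \<in> D \<longleftrightarrow> r z < 0" if "z \<in> U" for z
    using that by blast
  from \<open>C2_on r U\<close> obtain r' r'' where r': "\<And>z. z \<in> U \<Longrightarrow> (r has_derivative blinfun_apply (r' z)) (at z)"
    and r'': "\<And>z. z \<in> U \<Longrightarrow> (r' has_derivative blinfun_apply (r'' z)) (at z)"
    unfolding C2_on_def by blast
  have "open D" using D by (simp add: C2_strongly_pseudoconvex_domain_def)
  \<comment> \<open>The local description of \<open>D\<close> only speaks of \<open>r < 0\<close>.
    If \<open>r x\<close> were positive, continuity would give a neighbourhood of \<open>x\<close>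
    that misses \<open>D\<close>, although \<open>x\<close> lies in the closure.\<close>
  have r0: "r x = 0" if x: "x \<in> frontier D" "x \<in> U" for x
  proof -
    have "x \<notin> D" using x \<open>open D\<close> by (auto simp: frontier_def interior_open)
    then have "r x \<ge> 0" using DU[OF x(2)] by simp
    moreover have "r x \<le> 0"
    proof (rule ccontr)
      assume "\<not> r x \<le> 0"
      moreover have "isCont r x" using r'[OF x(2)] by (rule has_derivative_continuous)
      ultimately have "\<forall>\<^sub>F y in at x. r y > 0 \<and> y \<in> U"
        using U(1) x(2)
        by (intro eventually_conj) (auto simp: isCont_def order_tendsto_iff eventually_at_in_open' not_le)
      then obtain V where V: "open V" "x \<in> V" "\<And>y. y \<in> V \<Longrightarrow> y \<noteq> x \<Longrightarrow> r y > 0 \<and> y \<in> U"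
        unfolding eventually_at_topological by blast
      have "x \<in> closure D" using x by (auto simp: frontier_def)
      then obtain y where "y \<in> D" "y \<in> V" using V by (meson closure_iff_nhds_not_empty disjoint_iff order_refl)
      then show False using V(3)[of y] DU[of y] \<open>x \<notin> D\<close> by force
    qed
    ultimately show ?thesis by simp
  qed
  define f1 where "f1 = (\<lambda>t. \<chi> i. deriv (\<lambda>t. f t $ i) t)"
  have f1: "(f has_derivative (\<lambda>h. h *s f1 t)) (at t)" if "t \<in> S" for t
  proof (rule has_derivative_curve)
    fix i show "((\<lambda>t. f t $ i) has_field_derivative f1 t $ i) (at t)"
      unfolding f1_def vec_lambda_beta by (rule holomorphic_derivI[OF f S(1) that])
  qed
  define f2 where "f2 = (\<chi> i. deriv (\<lambda>t. f1 t $ i) p)"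
  have f2: "(f1 has_derivative (\<lambda>h. h *s f2)) (at p)"
  proof (rule has_derivative_curve)
    fix i show "((\<lambda>t. f1 t $ i) has_field_derivative f2 $ i) (at p)"
      unfolding f1_def f2_def vec_lambda_beta
      by (rule holomorphic_derivI[OF holomorphic_deriv[OF f S(1)] S])
  qed
  have "continuous_on S f"
    using f1 by (meson continuous_at_imp_continuous_on has_derivative_continuous)
  define T where "T = S \<inter> f -` U"
  have T: "open T" "p \<in> T" "T \<subseteq> S" "f ` T \<subseteq> U"
    using \<open>continuous_on S f\<close> S U unfolding T_def
    by (auto simp: continuous_on_open_vimage Int_commute)
  have tan: "r' (f t) (h *s f1 t) = 0" if "t \<in> T" for t h
  proof -
    have "((\<lambda>t. r (f t)) has_derivative (\<lambda>h. r' (f t) (h *s f1 t))) (at t)"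
      using that T by (intro has_derivative_compose[OF f1 r']) auto
    moreover have "((\<lambda>t. r (f t)) has_derivative (\<lambda>h. 0)) (at t)"
      by (rule has_derivative_transform_within_open[OF has_derivative_const T(1) that])
        (use T fr r0 in \<open>simp add: image_subset_iff subset_iff\<close>)
    ultimately have "(\<lambda>h. r' (f t) (h *s f1 t)) = (\<lambda>h. 0)" by (rule has_derivative_unique)
    then show ?thesis by metis
  qed
  have second: "r'' (f p) (k *s f1 p) (h *s f1 p) + r' (f p) (h *s (k *s f2)) = 0" for h k
  proof -
    have bl: "bounded_linear (\<lambda>v :: complex ^ 'n. h *s v)"
      by (simp add: linear_conv_bounded_linear[symmetric] linearI vector_add_ldistrib vec_eq_iff)
    have "((\<lambda>t. r' (f t) (h *s f1 t)) has_derivative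
        (\<lambda>k. r' (f p) (h *s (k *s f2)) + r'' (f p) (k *s f1 p) (h *s f1 p))) (at p)"
      by (rule bounded_bilinear.FDERIV[OF bounded_bilinear_blinfun_apply
            has_derivative_compose[OF f1 r''] bounded_linear.has_derivative[OF bl f2]])
         (use S U in auto)
    moreover have "((\<lambda>t. r' (f t) (h *s f1 t)) has_derivative (\<lambda>h. 0)) (at p)"
      by (rule has_derivative_transform_within_open[OF has_derivative_const T(1,2)])
        (use tan in auto)
    ultimately have "(\<lambda>k. r' (f p) (h *s (k *s f2)) + r'' (f p) (k *s f1 p) (h *s f1 p)) = (\<lambda>k. 0)"
      by (rule has_derivative_unique)
    then show ?thesis by (metis add.commute)
  qed
  \<comment> \<open>The acceleration terms for \<open>h = k = 1\<close> and for
    \<open>h = k = \<i>\<close> have opposite signs and cancel in the sum. What remains is four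
    times the Levi form.\<close>
  have "levi_form r (f p) (f1 p) = 0"
    using second[of 1 1] second[of \<i> \<i>]
    by (subst levi_form_eq[OF U(1,2) r' r''[OF U(2)]])
       (auto simp: ii_scale_ii_scale blinfun.minus_right)
  moreover have "f1 p \<in> complex_tangent_space r (f p)"
    using tan[OF T(2), of 1] tan[OF T(2), of \<i>]
    by (simp add: complex_tangent_space_def sum_wirtinger[OF r'[OF U(2)]])
  ultimately have "f1 p = 0" using levi by fastforce
  then show ?thesis by (simp add: f1_def vec_eq_iff)
qed

section \<open>Normal families and discs close to the boundary\<close>

lemma Montel_vec:
  fixes f :: "nat \<Rightarrow> complex \<Rightarrow> complex ^ 'n::finite"
  assumes S: "open S" and hol: "\<And>n i. (\<lambda>z. f n z $ i) holomorphic_on S"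
    and bd: "\<And>n z. z \<in> S \<Longrightarrow> norm (f n z) \<le> B"
  obtains g :: "complex \<Rightarrow> complex ^ 'n" and s :: "nat \<Rightarrow> nat" where "strict_mono s"
    "\<And>i. (\<lambda>z. g z $ i) holomorphic_on S"
    "\<And>i K. compact K \<Longrightarrow> K \<subseteq> S \<Longrightarrow>
       uniform_limit K (\<lambda>n z. f (s n) z $ i) (\<lambda>z. g z $ i) sequentially"
proof -
  \<comment> \<open>Induction over the set of coordinates: each new coordinate costs one application
    of the scalar Montel theorem and a further subsequence.\<close>
  have "\<exists>g s. strict_mono (s :: nat \<Rightarrow> nat) \<and> (\<forall>i\<in>A. g i holomorphic_on S \<and>
     (\<forall>K. compact K \<longrightarrow> K \<subseteq> S \<longrightarrow> uniform_limit K (\<lambda>n z. f (s n) z $ i) (g i) sequentially))" for A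
    using finite[of A]
  proof induction
    case empty
    show ?case using strict_mono_id by auto
  next
    case (insert i A)
    then obtain g s where s: "strict_mono (s :: nat \<Rightarrow> nat)" and g: "\<And>k. k \<in> A \<Longrightarrow> g k holomorphic_on S"
      and lim: "\<And>k K. k \<in> A \<Longrightarrow> compact K \<Longrightarrow> K \<subseteq> S \<Longrightarrow>
         uniform_limit K (\<lambda>n z. f (s n) z $ k) (g k) sequentially" by blast
    define H where "H = range (\<lambda>n z. f (s n) z $ i)"
    obtain h r where h: "h holomorphic_on S" and r: "strict_mono (r :: nat \<Rightarrow> nat)"
      and hlim: "\<And>K. compact K \<Longrightarrow> K \<subseteq> S \<Longrightarrow> uniform_limit K ((\<lambda>n z. f (s n) z $ i) \<circ> r) h sequentially"
    proof (rule Montel[OF S, of H "\<lambda>n z. f (s n) z $ i"])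
      show "h holomorphic_on S" if "h \<in> H" for h using that hol by (auto simp: H_def)
      show "\<exists>B. \<forall>h\<in>H. \<forall>z\<in>K. cmod (h z) \<le> B" if "K \<subseteq> S" for K
        unfolding H_def using order_trans[OF Finite_Cartesian_Product.norm_nth_le bd] that by blast
    qed (auto simp: H_def)
    have "uniform_limit K (\<lambda>n z. f ((s \<circ> r) n) z $ k) ((g(i := h)) k) sequentially"
      if "k \<in> insert i A" "compact K" "K \<subseteq> S" for k K
    proof (cases "k = i")
      case True
      then show ?thesis using hlim[OF that(2,3)] by (simp add: o_def)
    next
      case False
      then show ?thesis
        using filterlim_compose[OF lim[of k K] filterlim_subseq[OF r]] that by simp
    qed
    moreover have "strict_mono (s \<circ> r)" using s r by (rule strict_mono_o)
    moreover have "(g(i := h)) k holomorphic_on S" if "k \<in> insert i A" for k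
      using that g h by auto
    ultimately show ?case by (intro exI[of _ "g(i := h)"] exI[of _ "s \<circ> r"]) blast
  qed
  from this[of UNIV] obtain g s where "strict_mono (s :: nat \<Rightarrow> nat)" "\<And>i. g i holomorphic_on S"
    "\<And>i K. compact K \<Longrightarrow> K \<subseteq> S \<Longrightarrow> uniform_limit K (\<lambda>n z. f (s n) z $ i) (g i) sequentially"
    by blast
  then show thesis by (intro that[of s "\<lambda>z. \<chi> i. g i z"]) auto
qed

text \<open>Proof by compactness: if every set of an exhaustion by compacts failed, the offending
  discs would have a limit disc inside the frontier. That limit is constant by
  \<open>holomorphic_curve_in_frontier\<close>, and uniform convergence on the closed half disc
  contradicts an oscillation larger than \<delta>.\<close>

lemma small_discs_near_frontier:
  fixes D :: "(complex ^ 'n::finite) set"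
  assumes D: "C2_strongly_pseudoconvex_domain D" and "\<delta> > 0"
  obtains K where "compact K" "K \<subseteq> D"
    "\<And>(f :: complex \<Rightarrow> complex ^ 'n) x y i. (\<And>i. (\<lambda>z. f z $ i) holomorphic_on ball 0 1) \<Longrightarrow> f ` ball 0 1 \<subseteq> D - K \<Longrightarrow>
       x \<in> cball 0 (1/2) \<Longrightarrow> y \<in> cball 0 (1/2) \<Longrightarrow> cmod (f x $ i - f y $ i) \<le> \<delta>"
proof -
  have "open D" "bounded D" using D by (auto simp: C2_strongly_pseudoconvex_domain_def)
  \<comment> \<open>\<open>K n\<close> keeps the points of the closure at distance at least 1/(n+1)
    from the frontier. \<open>Suc\<close> makes the radius positive and finite for every
    \<open>n\<close>, so frontier points are always removed.\<close>
  define K where "K n = closure D - (\<Union>y\<in>frontier D. ball y (inverse (Suc n)))" for n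
  have K: "compact (K n)" "K n \<subseteq> D" for n
  proof -
    have "closed (K n)" unfolding K_def by (intro closed_Diff open_UN) auto
    moreover have "bounded (K n)" using \<open>bounded D\<close>
      by (metis K_def bounded_closure bounded_diff)
    ultimately show "compact (K n)" by (simp add: compact_eq_bounded_closed)
    show "K n \<subseteq> D"
    proof
      fix x assume x: "x \<in> K n"
      then have "x \<in> closure D" by (simp add: K_def)
      moreover have "x \<notin> frontier D" using x by (auto simp: K_def)
      ultimately show "x \<in> D" using \<open>open D\<close> by (simp add: frontier_def interior_open)
    qed
  qed
  show thesis
  proof (rule ccontr)
    assume neg: "\<not> thesis"
    have "\<exists>(f :: complex \<Rightarrow> complex ^ 'n) x y i. (\<forall>i. (\<lambda>z. f z $ i) holomorphic_on ball 0 1) \<and> f ` ball 0 1 \<subseteq> D - K n \<and>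
       x \<in> cball 0 (1/2) \<and> y \<in> cball 0 (1/2) \<and> cmod (f x $ i - f y $ i) > \<delta>" for n
    proof (rule ccontr)
      assume c: "\<nexists>(f :: complex \<Rightarrow> complex ^ 'n) x y i. (\<forall>i. (\<lambda>z. f z $ i) holomorphic_on ball 0 1) \<and> f ` ball 0 1 \<subseteq> D - K n \<and>
       x \<in> cball 0 (1/2) \<and> y \<in> cball 0 (1/2) \<and> cmod (f x $ i - f y $ i) > \<delta>"
      have thesis
      proof (rule that[OF K[of n]])
        fix f :: "complex \<Rightarrow> complex ^ 'n" and x y :: complex and i :: 'n
        assume "\<And>i. (\<lambda>z. f z $ i) holomorphic_on ball 0 1" "f ` ball 0 1 \<subseteq> D - K n"
          "x \<in> cball 0 (1/2)" "y \<in> cball 0 (1/2)"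
        then show "cmod (f x $ i - f y $ i) \<le> \<delta>"
          using c by (metis not_less)
      qed
      with neg show False ..
    qed
    then obtain f x y i where f: "\<And>n i. (\<lambda>z. f n z $ i) holomorphic_on ball 0 1"
      and fK: "\<And>n. f n ` ball 0 1 \<subseteq> D - K n"
      and xy: "\<And>n. x n \<in> cball 0 (1/2)" "\<And>n. y n \<in> cball 0 (1/2)"
      and far: "\<And>n. cmod (f n (x n) $ i n - f n (y n) $ i n) > \<delta>" by metis
    obtain B where B: "\<And>w. w \<in> D \<Longrightarrow> norm w \<le> B" using \<open>bounded D\<close> by (auto simp: bounded_iff)
    have "norm (f n z) \<le> B" if "z \<in> ball 0 1" for n z
      using B[of "f n z"] fK[of n] that by (simp add: image_subset_iff)
    with f obtain g s where s: "strict_mono (s :: nat \<Rightarrow> nat)"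
      and g: "\<And>i. (\<lambda>z. g z $ i) holomorphic_on ball 0 1"
      and lim: "\<And>i K. compact K \<Longrightarrow> K \<subseteq> ball 0 1 \<Longrightarrow>
         uniform_limit K (\<lambda>n z. f (s n) z $ i) (\<lambda>z. g z $ i) sequentially"
      using Montel_vec[of "ball 0 1" f B] open_ball by metis
    have "g z \<in> frontier D" if z: "z \<in> ball 0 1" for z
    proof -
      have "\<exists>y\<in>frontier D. dist y (f (s n) z) < inverse (Suc (s n))" for n
      proof -
        have "f (s n) z \<in> D - K (s n)" using fK[of "s n"] z by (simp add: image_subset_iff)
        then show ?thesis using closure_subset by (auto simp: K_def)
      qed
      then obtain y where y: "\<And>n. y n \<in> frontier D" "\<And>n. dist (y n) (f (s n) z) < inverse (Suc (s n))"
        by metis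
      have "(\<lambda>n. f (s n) z) \<longlonglongrightarrow> g z"
      proof (rule vec_tendstoI)
        fix i
        show "(\<lambda>n. f (s n) z $ i) \<longlonglongrightarrow> g z $ i"
          using tendsto_uniform_limitI[OF lim[of "{z}" i], of z] z by simp
      qed
      moreover have "(\<lambda>n. dist (y n) (f (s n) z)) \<longlonglongrightarrow> 0"
      proof (rule Lim_null_comparison)
        show "\<forall>\<^sub>F n in sequentially. norm (dist (y n) (f (s n) z)) \<le> inverse (real (Suc (s n)))"
          unfolding real_norm_def abs_of_nonneg[OF zero_le_dist]
          by (intro always_eventually allI less_imp_le y)
        show "(\<lambda>n. inverse (real (Suc (s n)))) \<longlonglongrightarrow> 0"
          by (rule filterlim_compose[OF LIMSEQ_inverse_real_of_nat filterlim_subseq[OF s]])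
      qed
      ultimately have "y \<longlonglongrightarrow> g z"
        using tendsto_add[of "\<lambda>n. f (s n) z" "g z" sequentially "\<lambda>n. y n - f (s n) z" 0]
        unfolding dist_norm tendsto_norm_zero_iff by simp
      then show ?thesis using y(1) closed_sequentially[OF frontier_closed] by blast
    qed
    then have "deriv (\<lambda>t. g t $ i) z = 0" if "z \<in> ball 0 1" for z i
      using holomorphic_curve_in_frontier[OF D open_ball that _ g] by blast
    then have d0: "((\<lambda>t. g t $ i) has_field_derivative 0) (at z)" if "z \<in> ball 0 1" for z i
      using holomorphic_derivI[OF g open_ball that, of i] that by metis
    have const: "g z $ i = g 0 $ i" if z: "z \<in> ball 0 1" for z i
    proof -
      obtain c where "\<forall>x\<in>ball 0 1. g x $ i = c"
        using has_field_derivative_zero_constant[of "ball 0 1" "\<lambda>t. g t $ i"]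
          has_field_derivative_at_within[OF d0] by (metis convex_ball)
      then show ?thesis using z by (metis centre_in_ball zero_less_one)
    qed
    have "\<forall>\<^sub>F n in sequentially. \<forall>z\<in>cball 0 (1/2). dist (f (s n) z $ i) (g z $ i) < \<delta>/2" for i
      using \<open>\<delta> > 0\<close> by (intro uniform_limitD lim) (auto simp: cball_subset_ball_iff)
    then have "\<forall>\<^sub>F n in sequentially. \<forall>i. \<forall>z\<in>cball 0 (1/2). dist (f (s n) z $ i) (g z $ i) < \<delta>/2"
      by (intro eventually_all_finite)
    then obtain n where n: "\<And>i z. z \<in> cball 0 (1/2) \<Longrightarrow> dist (f (s n) z $ i) (g z $ i) < \<delta>/2"
      using eventually_happens'[OF sequentially_bot] by blast
    have n0: "dist (f (s n) z $ i) (g 0 $ i) < \<delta>/2" if "z \<in> cball 0 (1/2)" for i z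
    proof -
      have "z \<in> ball 0 1" using that by simp
      then show ?thesis using n[OF that, of i] const[of z i] by simp
    qed
    have "dist (f (s n) (x (s n)) $ i (s n)) (f (s n) (y (s n)) $ i (s n)) < \<delta>"
      using n0[OF xy(1)] n0[OF xy(2)] by (rule dist_triangle_half_l)
    then show False using far[of "s n"] by (simp add: dist_norm)
  qed
qed

section \<open>Disc-valued functions on an exhaustion\<close>

lemma norm_vector_scalar_mult: "norm (c *s v) = cmod c * norm (v :: complex ^ 'n::finite)"
  by (simp add: norm_vec_def norm_mult L2_set_right_distrib)

text \<open>This rests on expanding |1 - cnj w z|^2 - |z - w|^2. It controls how close a Moebius
  image comes to the unit circle, both for the Harnack inequality and for the Blaschke
  factors.\<close>

lemma one_minus_norm_Moebius_function:
  assumes "cmod w < 1" "cmod z \<le> 1"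
  shows "1 - (cmod (Moebius_function 0 w z))\<^sup>2
       = (1 - (cmod w)\<^sup>2) * (1 - (cmod z)\<^sup>2) / (cmod (1 - cnj w * z))\<^sup>2"
proof -
  have "cmod (cnj w * z) \<le> cmod w"
    using mult_left_mono[OF assms(2), of "cmod w"] by (simp add: norm_mult)
  then have "1 - cnj w * z \<noteq> 0" using assms(1) by auto
  moreover have "(cmod (1 - cnj w * z))\<^sup>2 - (cmod (z - w))\<^sup>2 = (1 - (cmod w)\<^sup>2) * (1 - (cmod z)\<^sup>2)"
    unfolding cmod_power2 by (simp add: power2_eq_square algebra_simps)
  ultimately show ?thesis
    by (simp add: Moebius_function_simple norm_divide power_divide field_simps)
qed

text \<open>A Moebius map moves \<open>f 0\<close> to 0, the Schwarz lemma bounds the result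
  \<open>g\<close> by 1/2 at \<open>t\<close>, and the inverse Moebius map leads back. The constant
  is (1 - 1/4) / 2^2, from |g t| at most 1/2 and a denominator of modulus at most 2.\<close>

lemma Schwarz_Pick_half:
  assumes hol: "f holomorphic_on ball 0 1" and lt: "\<And>z. cmod z < 1 \<Longrightarrow> cmod (f z) < 1"
    and t: "cmod t \<le> 1/2"
  shows "3/16 * (1 - (cmod (f 0))\<^sup>2) \<le> 1 - (cmod (f t))\<^sup>2"
proof -
  define w where "w = f 0"
  define g where "g = Moebius_function 0 w \<circ> f"
  have w: "cmod w < 1" using lt by (simp add: w_def)
  have "g holomorphic_on ball 0 1" unfolding g_def
    using lt by (intro holomorphic_on_compose_gen[OF hol Moebius_function_holomorphic[OF w]]) auto
  moreover have "g 0 = 0" by (simp add: g_def w_def Moebius_function_eq_zero)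
  moreover have "cmod (g z) < 1" if "cmod z < 1" for z
    unfolding g_def o_def using Moebius_function_norm_lt_1[OF w lt[OF that]] .
  moreover have "cmod t < 1" using t by simp
  ultimately have "cmod (g t) \<le> cmod t" by (rule Schwarz_Lemma(1))
  then have g: "cmod (g t) \<le> 1/2" using t by simp
  have "f t = Moebius_function 0 (- w) (g t)"
    unfolding g_def o_def using Moebius_function_compose[of "- w" w "f t"] w lt[of t] t by simp
  then have eq: "1 - (cmod (f t))\<^sup>2 = (1 - (cmod w)\<^sup>2) * (1 - (cmod (g t))\<^sup>2) / (cmod (1 + cnj w * g t))\<^sup>2"
    using one_minus_norm_Moebius_function[of "- w" "g t"] w g by simp
  have 1: "1 - (cmod (g t))\<^sup>2 \<ge> 3/4"
    using power_mono[OF g, of 2] by (simp add: power2_eq_square)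
  have "cmod (cnj w * g t) \<le> 1 * 1" unfolding norm_mult using w g by (intro mult_mono) auto
  then have "cmod (1 + cnj w * g t) \<le> 2" using norm_triangle_ineq[of 1 "cnj w * g t"] by simp
  then have 2: "(cmod (1 + cnj w * g t))\<^sup>2 \<le> 4" using power_mono[of _ 2 2] by fastforce
  have "cmod (cnj w * g t) \<le> 1 * (1/2)" unfolding norm_mult using w g by (intro mult_mono) auto
  moreover have "cnj w * g t = - 1" if "1 + cnj w * g t = 0"
    using that by (simp add: add_eq_0_iff)
  ultimately have "1 + cnj w * g t \<noteq> 0" by fastforce
  then have 3: "(cmod (1 + cnj w * g t))\<^sup>2 > 0" by simp
  have w2: "1 - (cmod w)\<^sup>2 \<ge> 0" using w by (simp add: abs_square_le_1)
  have "3/16 * (1 - (cmod w)\<^sup>2) = (1 - (cmod w)\<^sup>2) * (3/4) / 4" by simp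
  also have "\<dots> \<le> (1 - (cmod w)\<^sup>2) * (1 - (cmod (g t))\<^sup>2) / (cmod (1 + cnj w * g t))\<^sup>2"
    using 1 2 3 w2 by (intro frac_le mult_nonneg_nonneg mult_left_mono) auto
  finally show ?thesis unfolding eq by (simp add: w_def)
qed

text \<open>Holomorphy is only required along complex lines, which is all that the Schwarz lemma uses.\<close>

definition disc_function_on :: "(complex ^ 'n::finite \<Rightarrow> complex) \<Rightarrow> (complex ^ 'n) set \<Rightarrow> bool" where
  "disc_function_on h U \<longleftrightarrow> (\<forall>z\<in>U. cmod (h z) < 1) \<and>
     (\<forall>x v. (\<lambda>t. h (x + t *s v)) holomorphic_on {t. x + t *s v \<in> U})"

lemma disc_function_on_ball:
  fixes x :: "complex ^ 'n::finite"
  assumes h: "disc_function_on h U" and U: "ball x e \<subseteq> U" and v: "norm v < e"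
  shows "(\<lambda>t. h (x + t *s v)) holomorphic_on ball 0 1"
    and "cmod t < 1 \<Longrightarrow> cmod (h (x + t *s v)) < 1"
proof -
  have *: "x + t *s v \<in> U" if "cmod t < 1" for t
  proof -
    have "cmod t * norm v \<le> 1 * norm v" using that by (intro mult_right_mono) auto
    then have "norm (t *s v) < e" using v by (simp add: norm_vector_scalar_mult)
    then show ?thesis using U by (auto simp: dist_norm)
  qed
  show "cmod t < 1 \<Longrightarrow> cmod (h (x + t *s v)) < 1" using h * by (simp add: disc_function_on_def)
  have "(\<lambda>t. h (x + t *s v)) holomorphic_on {t. x + t *s v \<in> U}"
    using h by (simp add: disc_function_on_def)
  then show "(\<lambda>t. h (x + t *s v)) holomorphic_on ball 0 1"
    by (rule holomorphic_on_subset) (use * in auto)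
qed

lemma disc_function_on_Harnack:
  fixes x y :: "complex ^ 'n::finite"
  assumes h: "disc_function_on h U" and U: "ball x e \<subseteq> U" and y: "dist x y < e/2"
  shows "3/16 * (1 - (cmod (h x))\<^sup>2) \<le> 1 - (cmod (h y))\<^sup>2"
proof -
  \<comment> \<open>The factor 2 puts \<open>y\<close> at the parameter 1/2, and
    \<open>dist x y < e/2\<close> keeps the whole unit disc of parameters inside the ball.\<close>
  define v where "v = 2 *s (y - x)"
  have "norm v = 2 * norm (y - x)" unfolding v_def norm_vector_scalar_mult by simp
  then have v: "norm v < e" using y by (simp add: dist_norm norm_minus_commute)
  have "x + (1/2) *s v = y" by (simp add: v_def vec_eq_iff)
  then show ?thesis
    using Schwarz_Pick_half[OF disc_function_on_ball[OF h U v], of "1/2"] by simp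
qed

lemma disc_function_on_Schwarz:
  fixes q x :: "complex ^ 'n::finite"
  assumes h: "disc_function_on h U" and U: "ball q r \<subseteq> U" and "h q = 0"
    and x: "dist q x < e" "e < r"
  shows "cmod (h x) * e \<le> dist q x"
proof (cases "x = q")
  case False
  define d where "d = dist q x"
  have d: "d > 0" "d < e" using False x by (simp_all add: d_def)
  then have "e > 0" by linarith
  \<comment> \<open>\<open>v\<close> points from \<open>q\<close> to \<open>x\<close> and has norm
    \<open>e\<close>, so \<open>x\<close> sits at the parameter \<open>d / e\<close>; the strict
    inequality \<open>e < r\<close> keeps the disc inside the ball.\<close>
  define v where "v = of_real (e / d) *s (x - q)"
  have "norm v = e" using d \<open>e > 0\<close> unfolding v_def norm_vector_scalar_mult
    by (simp add: d_def dist_norm norm_minus_commute del: of_real_divide)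
  then have v: "norm v < r" using x by simp
  have "x = q + of_real (d / e) *s v" using d by (simp add: v_def vec_eq_iff)
  moreover have "cmod (of_real (d / e)) = d / e" "d / e < 1" using d by (simp_all add: norm_divide)
  ultimately have "cmod (h x) \<le> d / e"
    using Schwarz_Lemma(1)[OF disc_function_on_ball(1)[OF h U v], of "of_real (d / e)"]
      disc_function_on_ball(2)[OF h U v] \<open>h q = 0\<close> by (simp del: of_real_divide)
  then show ?thesis using d by (simp add: d_def field_simps)
qed (use assms in simp)

section \<open>Harnack estimates that are uniform along the exhaustion\<close>

lemma compact_subset_incseq:
  fixes E :: "nat \<Rightarrow> 'a::topological_space set"
  assumes E: "incseq E" "\<And>j. open (E j)" and K: "compact K" "K \<subseteq> (\<Union>j. E j)"
  obtains J where "\<And>j. j \<ge> J \<Longrightarrow> K \<subseteq> E j"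
proof -
  obtain C where C: "finite C" "K \<subseteq> (\<Union>j\<in>C. E j)"
    using compactE_image[OF K(1), of UNIV E] E(2) K(2) by auto
  show thesis
  proof
    fix j assume "j \<ge> Max (insert 0 C)"
    then have "E i \<subseteq> E j" if "i \<in> C" for i
      using that C(1) by (intro incseqD[OF E(1)]) auto
    then show "K \<subseteq> E j" using C(2) by blast
  qed
qed

text \<open>The point is that \<open>c\<close> depends neither on \<open>j\<close> nor on
  \<open>h\<close>. Small closed balls in \<open>D\<close> lie in all late \<open>E j\<close>, which
  gives a local estimate with constant 3/16; connectedness chains such estimates from point to
  point, and compactness of \<open>K\<close> makes the constant uniform in \<open>w\<close>.\<close>

lemma disc_functions_Harnack_exhaustion:
  fixes E :: "nat \<Rightarrow> (complex ^ 'n::finite) set"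
  assumes E: "incseq E" "\<And>j. open (E j)" and D: "connected D" "D = (\<Union>j. E j)"
    and K: "compact K" "K \<subseteq> D" and q: "q \<in> D"
  obtains c J where "c > 0"
    "\<And>j h w. j \<ge> J \<Longrightarrow> disc_function_on h (E j) \<Longrightarrow> w \<in> K \<Longrightarrow>
       c * (1 - (cmod (h w))\<^sup>2) \<le> 1 - (cmod (h q))\<^sup>2"
proof -
  \<comment> \<open>Comparability is stated in both directions to make \<open>R\<close> symmetric,
    as the connectedness principle for equivalence relations requires.\<close>
  define R where "R x y \<longleftrightarrow> (\<exists>c J. c > 0 \<and> (\<forall>j h. j \<ge> J \<longrightarrow> disc_function_on h (E j) \<longrightarrow>
      c * (1 - (cmod (h x))\<^sup>2) \<le> 1 - (cmod (h y))\<^sup>2 \<and> c * (1 - (cmod (h y))\<^sup>2) \<le> 1 - (cmod (h x))\<^sup>2))"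
    for x y :: "complex ^ 'n"
  have "open D" using D E by auto
  have tr: "c * d * x \<le> z" if "c * x \<le> y" "d * y \<le> z" "d > 0" for c d x y z :: real

    using order_trans[OF mult_left_mono[OF that(1), of d] that(2)] that(3) by (simp add: mult_ac)
  have local: "\<exists>e>0. \<exists>J. ball x e \<subseteq> D \<and> (\<forall>y\<in>ball x e. \<forall>j h. j \<ge> J \<longrightarrow> disc_function_on h (E j) \<longrightarrow>
      3/16 * (1 - (cmod (h x))\<^sup>2) \<le> 1 - (cmod (h y))\<^sup>2 \<and> 3/16 * (1 - (cmod (h y))\<^sup>2) \<le> 1 - (cmod (h x))\<^sup>2)"
    if x: "x \<in> D" for x
  proof -
    obtain e where e: "e > 0" "cball x e \<subseteq> D"
      using open_contains_cball[THEN iffD1, OF \<open>open D\<close>] x by metis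
    obtain J where J: "\<And>j. j \<ge> J \<Longrightarrow> cball x e \<subseteq> E j"
      using compact_subset_incseq[OF E compact_cball] e(2) D(2) by metis
    \<comment> \<open>For \<open>y\<close> within \<open>e/4\<close> of \<open>x\<close>, the ball
      of radius \<open>e/2\<close> about \<open>y\<close> still lies in \<open>E j\<close>, so the
      Harnack inequality may be centred at either point.\<close>
    have "3/16 * (1 - (cmod (h x))\<^sup>2) \<le> 1 - (cmod (h y))\<^sup>2"
      "3/16 * (1 - (cmod (h y))\<^sup>2) \<le> 1 - (cmod (h x))\<^sup>2"
      if y: "y \<in> ball x (e/4)" and "j \<ge> J" and h: "disc_function_on h (E j)" for y j h
    proof -
      have 1: "ball x e \<subseteq> E j" using J[OF \<open>j \<ge> J\<close>] ball_subset_cball by blast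
      moreover have "ball y (e/2) \<subseteq> ball x e"
        using y e(1) by (simp add: ball_subset_ball_iff dist_commute)
      ultimately have 2: "ball y (e/2) \<subseteq> E j" by blast
      show "3/16 * (1 - (cmod (h x))\<^sup>2) \<le> 1 - (cmod (h y))\<^sup>2"
        using y e by (intro disc_function_on_Harnack[OF h 1]) simp
      show "3/16 * (1 - (cmod (h y))\<^sup>2) \<le> 1 - (cmod (h x))\<^sup>2"
        using y by (intro disc_function_on_Harnack[OF h 2]) (simp add: dist_commute)
    qed
    moreover have "ball x (e/4) \<subseteq> cball x e" using e(1) by (simp add: ball_subset_cball_iff)
    then have "ball x (e/4) \<subseteq> D" using e(2) by (rule order_trans)
    ultimately show ?thesis using e(1) by (intro exI[of _ "e/4"] conjI exI[of _ J]) simp_all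
  qed
  have R: "R x y" if "x \<in> D" "y \<in> D" for x y
  proof (rule connected_equivalence_relation[OF D(1) that])
    show "R y x" if "R x y" for x y using that unfolding R_def by blast
    show "R x z" if "R x y" "R y z" for x y z
    proof -
      obtain c J where c: "c > 0" "\<And>j h. j \<ge> J \<Longrightarrow> disc_function_on h (E j) \<Longrightarrow>
        c * (1 - (cmod (h x))\<^sup>2) \<le> 1 - (cmod (h y))\<^sup>2 \<and> c * (1 - (cmod (h y))\<^sup>2) \<le> 1 - (cmod (h x))\<^sup>2"
        using \<open>R x y\<close> unfolding R_def by metis
      obtain d L where d: "d > 0" "\<And>j h. j \<ge> L \<Longrightarrow> disc_function_on h (E j) \<Longrightarrow>
        d * (1 - (cmod (h y))\<^sup>2) \<le> 1 - (cmod (h z))\<^sup>2 \<and> d * (1 - (cmod (h z))\<^sup>2) \<le> 1 - (cmod (h y))\<^sup>2"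
        using \<open>R y z\<close> unfolding R_def by metis
      have "c * d * (1 - (cmod (h x))\<^sup>2) \<le> 1 - (cmod (h z))\<^sup>2 \<and> c * d * (1 - (cmod (h z))\<^sup>2) \<le> 1 - (cmod (h x))\<^sup>2"
        if "j \<ge> max J L" "disc_function_on h (E j)" for j h
      proof -
        have j: "j \<ge> J" "j \<ge> L" using that by auto
        note c' = c(2)[OF j(1) that(2)] and d' = d(2)[OF j(2) that(2)]
        show ?thesis
          using tr[OF conjunct1[OF c'] conjunct1[OF d'] d(1)]
            tr[OF conjunct2[OF d'] conjunct2[OF c'] c(1)] by (simp add: mult.commute)
      qed
      then show ?thesis unfolding R_def using c(1) d(1) by (intro exI[of _ "c * d"] exI[of _ "max J L"]) auto
    qed
    show "\<exists>T. openin (top_of_set D) T \<and> x \<in> T \<and> (\<forall>y\<in>T. R x y)" if "x \<in> D" for x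
    proof -
      obtain e J where e: "e > 0" "ball x e \<subseteq> D" "\<forall>y\<in>ball x e. \<forall>j h. j \<ge> J \<longrightarrow> disc_function_on h (E j) \<longrightarrow>
      3/16 * (1 - (cmod (h x))\<^sup>2) \<le> 1 - (cmod (h y))\<^sup>2 \<and> 3/16 * (1 - (cmod (h y))\<^sup>2) \<le> 1 - (cmod (h x))\<^sup>2"
        using local[OF \<open>x \<in> D\<close>] by metis
      have "R x y" if "y \<in> ball x e" for y
        unfolding R_def using e(3) that by (intro exI[of _ "3/16"] exI[of _ J]) auto
      moreover have "openin (top_of_set D) (ball x e)"
        using e(2) by (simp add: openin_open_eq \<open>open D\<close>)
      ultimately show ?thesis using e(1) by (intro exI[of _ "ball x e"]) auto
    qed
  qed
  have "\<exists>e>0. \<exists>c>0. \<exists>J. \<forall>w\<in>ball x e. \<forall>j h. j \<ge> J \<longrightarrow> disc_function_on h (E j) \<longrightarrow>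
       c * (1 - (cmod (h w))\<^sup>2) \<le> 1 - (cmod (h q))\<^sup>2" if x: "x \<in> D" for x
  proof -
    obtain e J where e: "e > 0" "\<And>y j h. y \<in> ball x e \<Longrightarrow> j \<ge> J \<Longrightarrow> disc_function_on h (E j) \<Longrightarrow>
      3/16 * (1 - (cmod (h y))\<^sup>2) \<le> 1 - (cmod (h x))\<^sup>2"
      using local[OF x] by metis
    obtain c L where c: "c > 0" "\<And>j h. j \<ge> L \<Longrightarrow> disc_function_on h (E j) \<Longrightarrow>
        c * (1 - (cmod (h x))\<^sup>2) \<le> 1 - (cmod (h q))\<^sup>2"
      using R[OF x q] unfolding R_def by metis
    have "c * (3/16) * (1 - (cmod (h w))\<^sup>2) \<le> 1 - (cmod (h q))\<^sup>2"
      if "w \<in> ball x e" "j \<ge> max J L" "disc_function_on h (E j)" for w j h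
      using tr[OF e(2)[OF that(1) _ that(3)] c(2)[OF _ that(3)] c(1)] that(2) by (simp add: mult.commute)
    then show ?thesis using e(1) c(1)
      by (intro exI[of _ e] exI[of _ "c * (3/16)"] conjI exI[of _ "max J L"]) auto
  qed
  then obtain e c J where e: "\<And>x. x \<in> D \<Longrightarrow> e x > 0" and c: "\<And>x. x \<in> D \<Longrightarrow> c x > 0"
    and J: "\<And>x w j h. x \<in> D \<Longrightarrow> w \<in> ball x (e x) \<Longrightarrow> j \<ge> (J x :: nat) \<Longrightarrow> disc_function_on h (E j) \<Longrightarrow>
       c x * (1 - (cmod (h w))\<^sup>2) \<le> 1 - (cmod (h q))\<^sup>2" by metis
  obtain C where C: "C \<subseteq> K" "finite C" "K \<subseteq> (\<Union>x\<in>C. ball x (e x))"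
    by (rule compactE_image[OF K(1), of K "\<lambda>x. ball x (e x)"]) (use e K in force)+
  obtain J0 where J0: "\<And>j. j \<ge> J0 \<Longrightarrow> K \<subseteq> E j"
    using compact_subset_incseq[OF E K(1)] K(2) D(2) by metis
  \<comment> \<open>Inserting 1 covers the case of an empty \<open>C\<close>.\<close>
  define c' where "c' = Min (insert 1 (c ` C))"
  show thesis
  proof
    show "c' > 0" unfolding c'_def using C K c by (subst Min_gr_iff) auto
    fix j h w assume j: "j \<ge> Max (insert J0 (J ` C))" and h: "disc_function_on h (E j)" and w: "w \<in> K"
    obtain x where x: "x \<in> C" "w \<in> ball x (e x)" using C(3) w by blast
    have xD: "x \<in> D" using x(1) C(1) K(2) by blast
    \<comment> \<open>\<open>J0\<close> guarantees that \<open>w\<close> lies in \<open>E j\<close>.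
      Then \<open>1 - (cmod (h w))\<^sup>2\<close> is nonnegative, and \<open>c x\<close> can be
      lowered to \<open>c'\<close>.\<close>
    have "J0 \<le> Max (insert J0 (J ` C))" using C(2) by (intro Max_ge) auto
    then have "w \<in> E j" using J0[of j] j w by auto
    then have "cmod (h w) < 1" using h by (simp add: disc_function_on_def)
    then have "(cmod (h w))\<^sup>2 \<le> 1" by (simp add: abs_square_le_1)
    moreover have "c' \<le> c x" unfolding c'_def using x(1) C(2) by (intro Min_le) auto
    ultimately have "c' * (1 - (cmod (h w))\<^sup>2) \<le> c x * (1 - (cmod (h w))\<^sup>2)"
      by (intro mult_right_mono) auto
    moreover have "J x \<le> Max (insert J0 (J ` C))" using x(1) C(2) by (intro Max_ge) auto
    then have "c x * (1 - (cmod (h w))\<^sup>2) \<le> 1 - (cmod (h q))\<^sup>2"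
      using J[OF xD x(2) _ h] j by linarith
    ultimately show "c' * (1 - (cmod (h w))\<^sup>2) \<le> 1 - (cmod (h q))\<^sup>2" by simp
  qed
qed

section \<open>Blaschke products on the symmetrized polydisc\<close>

text \<open>This is the homogenized generating polynomial of the elementary symmetric functions,
  with \<open>s $ i\<close> in place of the one of degree \<open>card {..i}\<close>. Being affine in
  \<open>s\<close>, it turns symmetric products over the coordinates into holomorphic functions on
  the symmetrized side.\<close>

definition symmetric_linear_form :: "complex \<Rightarrow> complex \<Rightarrow> complex ^ 'n::{finite,linorder} \<Rightarrow> complex" where
  "symmetric_linear_form x y s =
     x ^ CARD('n) + (\<Sum>i\<in>UNIV. x ^ (CARD('n) - card {..i}) * y ^ card {..i} * s $ i)"

lemma bij_betw_card_atMost: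
  "bij_betw (\<lambda>i :: 'n::{finite,linorder}. card {..i}) UNIV {1..CARD('n)}"
proof -
  have "strict_mono (\<lambda>i :: 'n. card {..i})"
    by (intro strict_monoI psubset_card_mono) auto
  then have inj: "inj (\<lambda>i :: 'n. card {..i})" by (rule strict_mono_imp_inj_on)
  moreover have "range (\<lambda>i :: 'n. card {..i}) \<subseteq> {1..CARD('n)}"
    by (auto simp: Suc_le_eq card_gt_0_iff intro!: card_mono)
  ultimately have "range (\<lambda>i :: 'n. card {..i}) = {1..CARD('n)}"
    by (intro card_subset_eq) (auto simp: card_image)
  with inj show ?thesis by (simp add: bij_betw_def)
qed

lemma elem_sym_0: "elem_sym 0 z = 1"
proof -
  have "{J :: 'a set. card J = 0} = {{}}" by (auto simp: card_eq_0_iff)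
  then show ?thesis by (simp add: elem_sym_def)
qed

text \<open>The product is expanded over subsets of the index set and grouped by their size; size 0
  yields the leading power of \<open>x\<close>, and the numbering \<open>card {..i}\<close> matches
  the other sizes with the coordinates.\<close>

lemma symmetric_linear_form_symmetrization:
  fixes z :: "complex ^ 'n::{finite,linorder}"
  shows "symmetric_linear_form x y (symmetrization z) = (\<Prod>i\<in>UNIV. x + y * z $ i)"
proof -
  let ?t = "\<lambda>k. x ^ (CARD('n) - k) * y ^ k * elem_sym k z"
  have "(\<Prod>i\<in>UNIV. x + y * z $ i) = (\<Prod>i\<in>UNIV. y * z $ i + x)" by (simp add: add.commute)
  also have "\<dots> = (\<Sum>J\<in>UNIV. (\<Prod>i\<in>J. y * z $ i) * (\<Prod>i\<in>UNIV-J. x))"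
    by (subst prod_add) simp_all
  also have "\<dots> = (\<Sum>J\<in>UNIV. x ^ (CARD('n) - card J) * y ^ card J * (\<Prod>j\<in>J. z $ j))"
    by (intro sum.cong refl) (simp add: prod.distrib card_Diff_subset mult_ac)
  also have "\<dots> = (\<Sum>k\<le>CARD('n). \<Sum>J | card J = k. x ^ (CARD('n) - card J) * y ^ card J * (\<Prod>j\<in>J. z $ j))"
    by (subst sum.group[of UNIV "{..CARD('n)}" card, symmetric]) (auto intro: card_mono)
  also have "\<dots> = (\<Sum>k\<le>CARD('n). ?t k)"
    by (intro sum.cong refl) (simp add: elem_sym_def sum_distrib_left)
  also have "{..CARD('n)} = insert 0 {1..CARD('n)}" by auto
  also have "(\<Sum>k\<in>insert 0 {1..CARD('n)}. ?t k) = x ^ CARD('n) + (\<Sum>k\<in>{1..CARD('n)}. ?t k)"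
    by (simp add: elem_sym_0)
  also have "(\<Sum>k\<in>{1..CARD('n)}. ?t k) = (\<Sum>i\<in>(UNIV :: 'n set). ?t (card {..i}))"
    by (rule sum.reindex_bij_betw[OF bij_betw_card_atMost, symmetric])
  finally show ?thesis by (simp add: symmetric_linear_form_def symmetrization_def)
qed

text \<open>As a quotient of two affine functions of \<open>s\<close>, it involves no choice of a
  preimage under \<open>symmetrization\<close>; on symmetrized points it is the product of the
  Moebius factors of the coordinates.\<close>

definition blaschke :: "complex \<Rightarrow> complex ^ 'n::{finite,linorder} \<Rightarrow> complex" where
  "blaschke c s = symmetric_linear_form (- c) 1 s / symmetric_linear_form 1 (- cnj c) s"

lemma blaschke_symmetrization:
  "blaschke c (symmetrization z) = (\<Prod>i\<in>UNIV. Moebius_function 0 c (z $ i))"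
  by (simp add: blaschke_def symmetric_linear_form_symmetrization Moebius_function_simple prod_dividef)

lemma norm_blaschke_symmetrization:
  "cmod (blaschke c (symmetrization z)) = (\<Prod>i\<in>UNIV. cmod (Moebius_function 0 c (z $ i)))"
  by (simp add: blaschke_symmetrization prod_norm)

lemma symmetric_linear_form_neq_0:
  assumes "cmod c < 1" "s \<in> symmetrized_polydisc"
  shows "symmetric_linear_form 1 (- cnj c) s \<noteq> 0"
proof -
  obtain z where z: "s = symmetrization z" "\<And>i. cmod (z $ i) < 1"
    using assms(2) by (auto simp: symmetrized_polydisc_def unit_polydisc_def)
  have "cnj c * z $ i \<noteq> 1" for i
    using norm_mult_less[of "cnj c" 1 "z $ i" 1] z(2) assms(1) by auto
  then show ?thesis by (simp add: z(1) symmetric_linear_form_symmetrization)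
qed

lemma disc_function_on_blaschke:
  fixes F :: "complex ^ 'm::finite \<Rightarrow> complex ^ 'n::{finite,linorder}"
  assumes F: "holomorphic_map_on F U" "F ` U \<subseteq> symmetrized_polydisc" and U: "open U" and c: "cmod c < 1"
  shows "disc_function_on (\<lambda>w. blaschke c (F w)) U"
  unfolding disc_function_on_def
proof (intro conjI ballI allI)
  fix w assume "w \<in> U"
  then obtain z where z: "F w = symmetrization z" "\<And>i. cmod (z $ i) < 1"
    using F(2) by (auto simp: symmetrized_polydisc_def unit_polydisc_def image_subset_iff image_iff)
  have "(\<Prod>i\<in>UNIV. cmod (Moebius_function 0 c (z $ i))) < (\<Prod>i\<in>(UNIV :: 'n set). 1)"
    by (intro prod_mono_strict) (auto intro: less_imp_le Moebius_function_norm_lt_1[OF c z(2)])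
  then show "cmod (blaschke c (F w)) < 1" by (simp add: z(1) norm_blaschke_symmetrization)
next
  fix x v :: "complex ^ 'm"
  let ?S = "{t. x + t *s v \<in> U}"
  have line: "(\<lambda>t. x + t *s v) = (\<lambda>t. \<chi> i. x $ i + t * v $ i)" by (simp add: fun_eq_iff vec_eq_iff)
  have "continuous_on UNIV (\<lambda>t. x + t *s v)"
    unfolding line by (intro continuous_intros)
  then have "open ((\<lambda>t. x + t *s v) -` U)" using U by (simp add: open_vimage)
  then have S: "open ?S" by (simp add: vimage_def)
  have hol: "(\<lambda>t. F (x + t *s v) $ i) holomorphic_on ?S" for i
    by (rule holomorphic_map_on_curve[OF F(1) S]) (auto intro!: holomorphic_intros)
  show "(\<lambda>t. blaschke c (F (x + t *s v))) holomorphic_on ?S"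
    unfolding blaschke_def
  proof (rule holomorphic_on_divide)
    fix t assume "t \<in> ?S"
    then show "symmetric_linear_form 1 (- cnj c) (F (x + t *s v)) \<noteq> 0"
      using F(2) by (intro symmetric_linear_form_neq_0[OF c]) auto
  qed (unfold symmetric_linear_form_def, (intro holomorphic_intros hol)+)
qed

lemma holomorphic_on_symmetrization:
  fixes \<gamma> :: "complex \<Rightarrow> complex ^ 'n::{finite,linorder}"
  assumes "\<And>i. (\<lambda>t. \<gamma> t $ i) holomorphic_on S"
  shows "(\<lambda>t. symmetrization (\<gamma> t) $ i) holomorphic_on S"
  unfolding symmetrization_def elem_sym_def vec_lambda_beta
  by (intro holomorphic_intros assms)

text \<open>Take the Blaschke product for the coordinate \<zeta> = \<open>z $ l\<close>. It vanishes
  at \<open>w\<close>, so the Harnack hypothesis keeps its modulus at \<open>q\<close> away from 1.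
  But if \<zeta> were near the unit circle, all its factors at the fixed point \<open>a\<close>
  would have modulus near 1.\<close>

lemma polydisc_image_escapes:
  fixes F :: "complex ^ 'm::finite \<Rightarrow> complex ^ 'n::{finite,linorder}"
  assumes F: "holomorphic_map_on F U" "F ` U \<subseteq> symmetrized_polydisc" and U: "open U"
    and a: "a \<in> unit_polydisc" "F q = symmetrization a"
    and c: "c > 0" and K: "\<And>h w. disc_function_on h U \<Longrightarrow> w \<in> K \<Longrightarrow>
       c * (1 - (cmod (h w))\<^sup>2) \<le> 1 - (cmod (h q))\<^sup>2"
  obtains r where "r < 1" "\<And>w z l. w \<in> K \<Longrightarrow> F w = symmetrization z \<Longrightarrow> z \<in> unit_polydisc \<Longrightarrow> cmod (z $ l) < r"
proof -
  \<comment> \<open>The sum collects the bounds on the \<open>M m\<close> below; the added 1 makes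
    \<open>S\<close> positive and yields the strict inequality at the end.\<close>
  define S where "S = (\<Sum>m\<in>UNIV. 1 / (1 - cmod (a $ m))\<^sup>2) + 1"
  have a1: "cmod (a $ m) < 1" for m using a(1) by (simp add: unit_polydisc_def)
  have "(\<Sum>m\<in>UNIV. 1 / (1 - cmod (a $ m))\<^sup>2) \<ge> 0" by (intro sum_nonneg) simp
  then have S: "S > 0" by (simp add: S_def)
  define e where "e = min 1 (c / S)"
  have e: "0 < e" "e \<le> 1" "e * S \<le> c" using c S by (auto simp: e_def min_def field_simps)
  show thesis
  proof
    show "sqrt (1 - e) < 1" using e by simp
    fix w z l assume w: "w \<in> K" "F w = symmetrization z" and z: "z \<in> unit_polydisc"
    define \<zeta> where "\<zeta> = z $ l"
    have \<zeta>: "cmod \<zeta> < 1" using z by (simp add: \<zeta>_def unit_polydisc_def)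
    define M where "M m = 1 - (cmod (Moebius_function 0 \<zeta> (a $ m)))\<^sup>2" for m
    have M: "0 \<le> M m" "M m \<le> 1" "M m \<le> (1 - (cmod \<zeta>)\<^sup>2) * (1 / (1 - cmod (a $ m))\<^sup>2)" for m
    proof -
      show "0 \<le> M m" "M m \<le> 1" using Moebius_function_norm_lt_1[OF \<zeta> a1, of 0 m]
        by (simp_all add: M_def abs_square_le_1)
      have "cmod (cnj \<zeta> * a $ m) \<le> 1 * cmod (a $ m)"
        unfolding norm_mult using \<zeta> by (intro mult_right_mono) auto
      then have "1 - cmod (a $ m) \<le> cmod (1 - cnj \<zeta> * a $ m)"
        using norm_triangle_ineq2[of 1 "cnj \<zeta> * a $ m"] by simp
      then have d: "(1 - cmod (a $ m))\<^sup>2 \<le> (cmod (1 - cnj \<zeta> * a $ m))\<^sup>2"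
        using a1[of m] by (intro power_mono) auto
      have "M m = (1 - (cmod \<zeta>)\<^sup>2) * (1 - (cmod (a $ m))\<^sup>2) / (cmod (1 - cnj \<zeta> * a $ m))\<^sup>2"
        using one_minus_norm_Moebius_function[OF \<zeta>, of "a $ m"] a1[of m] by (simp add: M_def)
      also have "\<dots> \<le> (1 - (cmod \<zeta>)\<^sup>2) * 1 / (1 - cmod (a $ m))\<^sup>2"
        using \<zeta> a1[of m] d by (intro frac_le mult_left_mono mult_nonneg_nonneg) (auto simp: abs_square_le_1)
      finally show "M m \<le> (1 - (cmod \<zeta>)\<^sup>2) * (1 / (1 - cmod (a $ m))\<^sup>2)" by simp
    qed
    define h where "h w = blaschke \<zeta> (F w)" for w
    have h: "disc_function_on h U" unfolding h_def by (rule disc_function_on_blaschke[OF F U \<zeta>])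
    have "Moebius_function 0 \<zeta> (z $ l) = 0" by (simp add: \<zeta>_def Moebius_function_eq_zero)
    then have "h w = 0" unfolding h_def w(2) blaschke_symmetrization by (intro prod_zero) auto
    then have "c \<le> 1 - (cmod (h q))\<^sup>2" using K[OF h w(1)] by simp
    also have "(cmod (h q))\<^sup>2 = (\<Prod>m\<in>UNIV. 1 - M m)"
      by (simp add: h_def a(2) norm_blaschke_symmetrization M_def prod_power_distrib)
    also have "1 - (\<Prod>m\<in>UNIV. 1 - M m) \<le> (\<Sum>m\<in>UNIV. M m)"
      using Weierstrass_prod_ineq[of UNIV M] M(1,2) by simp
    also have "\<dots> \<le> (\<Sum>m\<in>UNIV. (1 - (cmod \<zeta>)\<^sup>2) * (1 / (1 - cmod (a $ m))\<^sup>2))"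
      by (intro sum_mono M(3))
    also have "\<dots> = (1 - (cmod \<zeta>)\<^sup>2) * (S - 1)" unfolding sum_distrib_left[symmetric] by (simp add: S_def)
    finally have c_le: "c \<le> (1 - (cmod \<zeta>)\<^sup>2) * (S - 1)" .
    have pos: "1 - (cmod \<zeta>)\<^sup>2 > 0" using \<zeta> by (simp add: abs_square_less_1)
    have "e * S \<le> (1 - (cmod \<zeta>)\<^sup>2) * (S - 1)" using e(3) c_le by linarith
    also have "\<dots> < (1 - (cmod \<zeta>)\<^sup>2) * S" using pos by simp
    finally have "e < 1 - (cmod \<zeta>)\<^sup>2" using S by simp
    then have "(cmod \<zeta>)\<^sup>2 < 1 - e" by simp
    then show "cmod (z $ l) < sqrt (1 - e)" unfolding \<zeta>_def by (rule real_less_rsqrt)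
  qed
qed

section \<open>The Remmert--Stein argument\<close>

lemma symmetrization_curve:
  fixes \<gamma> :: "complex \<Rightarrow> complex ^ 'n::{finite,linorder}"
  assumes "holomorphic_map_on G symmetrized_polydisc" and "open S" and "\<gamma> ` S \<subseteq> unit_polydisc"
    and "\<And>i. (\<lambda>t. \<gamma> t $ i) holomorphic_on S"
  shows "(\<lambda>t. G (symmetrization (\<gamma> t)) $ i) holomorphic_on S"
  by (rule holomorphic_map_on_curve[OF assms(1,2) _ holomorphic_on_symmetrization[OF assms(4)]])
     (use assms(3) in \<open>auto simp: symmetrized_polydisc_def\<close>)

text \<open>A second coordinate \<open>l\<close> is set free. When its modulus is at least
  \<open>r\<close>, the discs obtained by moving coordinate \<open>k\<close> avoid \<open>K\<close>
  and are nearly constant; the maximum principle in coordinate \<open>l\<close> carries the bound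
  inward to \<open>z $ l\<close>. The map \<mu> allows a hyperbolic disc about any centre as the
  range of motion.\<close>

lemma polydisc_coordinate_step:
  fixes G :: "complex ^ 'n::{finite,linorder} \<Rightarrow> complex ^ 'm::finite"
  assumes G: "holomorphic_map_on G symmetrized_polydisc" "G ` symmetrized_polydisc \<subseteq> D"
    and disc: "\<And>(f :: complex \<Rightarrow> complex ^ 'm) x y i. (\<And>i. (\<lambda>z. f z $ i) holomorphic_on ball 0 1) \<Longrightarrow>
       f ` ball 0 1 \<subseteq> D - K \<Longrightarrow> x \<in> cball 0 (1/2) \<Longrightarrow> y \<in> cball 0 (1/2) \<Longrightarrow> cmod (f x $ i - f y $ i) \<le> \<delta>"
    and r: "r < 1" "\<And>z l. z \<in> unit_polydisc \<Longrightarrow> G (symmetrization z) \<in> K \<Longrightarrow> cmod (z $ l) < r"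
    and \<mu>: "\<mu> holomorphic_on ball 0 1" "\<And>t. cmod t < 1 \<Longrightarrow> cmod (\<mu> t) < 1"
    and card: "CARD('n) \<ge> 2" and z: "z \<in> unit_polydisc"
    and xy: "x \<in> cball 0 (1/2)" "y \<in> cball 0 (1/2)"
  shows "cmod (G (symmetrization (\<chi> m. if m = k then \<mu> x else z $ m)) $ i
             - G (symmetrization (\<chi> m. if m = k then \<mu> y else z $ m)) $ i) \<le> \<delta>"
proof -
  have "UNIV \<noteq> {k}"
  proof
    assume "UNIV = {k}"
    then have "CARD('n) = card {k}" by (rule arg_cong)
    then show False using card by simp
  qed
  then obtain l where l: "l \<noteq> k" by blast
  define Z where "Z t u = (\<chi> m. if m = k then \<mu> u else if m = l then t else z $ m)" for t u
  have Z: "Z t u \<in> unit_polydisc" if "cmod t < 1" "cmod u < 1" for t u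
    using that \<mu>(2) z by (simp add: Z_def unit_polydisc_def)
  have Zl: "Z (z $ l) u = (\<chi> m. if m = k then \<mu> u else z $ m)" for u
    by (simp add: Z_def vec_eq_iff)
  have hol1: "(\<lambda>t. G (symmetrization (Z t u)) $ i) holomorphic_on ball 0 1" if "cmod u < 1" for u
  proof (rule symmetrization_curve[OF G(1) open_ball])
    show "(\<lambda>t. Z t u) ` ball 0 1 \<subseteq> unit_polydisc" using Z that by auto
    show "(\<lambda>t. Z t u $ m) holomorphic_on ball 0 1" for m
      by (cases "m = k"; cases "m = l") (simp_all add: Z_def holomorphic_intros)
  qed
  have hol2: "(\<lambda>u. G (symmetrization (Z t u)) $ i) holomorphic_on ball 0 1" if "cmod t < 1" for t i
  proof (rule symmetrization_curve[OF G(1) open_ball])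
    show "(\<lambda>u. Z t u) ` ball 0 1 \<subseteq> unit_polydisc" using Z that by auto
    show "(\<lambda>u. Z t u $ m) holomorphic_on ball 0 1" for m
      by (cases "m = k"; cases "m = l") (simp_all add: Z_def holomorphic_intros \<mu>)
  qed
  \<comment> \<open>The circle of radius \<open>s\<close> must reach the escape radius
    \<open>r\<close>, enclose \<open>z $ l\<close> and have positive radius.\<close>
  define s where "s = max (max r (1/2)) ((1 + cmod (z $ l)) / 2)"
  have zl: "cmod (z $ l) < 1" using z by (simp add: unit_polydisc_def)
  have s: "0 < s" "s < 1" "r \<le> s" "cmod (z $ l) < s" using r(1) zl
    by (auto simp: s_def less_max_iff_disj)
  have x1: "cmod x < 1" "cmod y < 1" using xy by auto
  define g where "g t = G (symmetrization (Z t x)) $ i - G (symmetrization (Z t y)) $ i" for t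
  have g: "g holomorphic_on ball 0 1"
    unfolding g_def by (intro holomorphic_intros hol1 x1)
  have "cmod (g (z $ l)) \<le> \<delta>"
  proof (rule maximum_modulus_frontier[of g "ball 0 s"])
    show "g holomorphic_on interior (ball 0 s)"
      by (rule holomorphic_on_subset[OF g]) (use s in \<open>auto simp: interior_open\<close>)
    have "closure (ball 0 s) \<subseteq> ball (0 :: complex) 1" using s by (auto simp: cball_subset_ball_iff)
    then show "continuous_on (closure (ball 0 s)) g"
      by (rule continuous_on_subset[OF holomorphic_on_imp_continuous_on[OF g]])
    show "bounded (ball (0 :: complex) s)" by simp
    show "z $ l \<in> ball 0 s" using s by simp
    fix t assume "t \<in> frontier (ball (0 :: complex) s)"
    then have t: "cmod t = s" using s by simp
    show "cmod (g t) \<le> \<delta>"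
      unfolding g_def
    proof (rule disc[OF hol2 _ xy])
      show "cmod t < 1" using t s by simp
      have "G (symmetrization (Z t u)) \<in> D - K" if "cmod u < 1" for u
      proof -
        have "Z t u \<in> unit_polydisc" using Z t s that by simp
        moreover have "cmod (Z t u $ l) = s" using l t by (simp add: Z_def)
        ultimately have "G (symmetrization (Z t u)) \<notin> K"
          using r(2)[of "Z t u" l] s by auto
        moreover have "G (symmetrization (Z t u)) \<in> D"
          using G(2) \<open>Z t u \<in> unit_polydisc\<close> by (auto simp: symmetrized_polydisc_def)
        ultimately show ?thesis by simp
      qed
      then show "(\<lambda>u. G (symmetrization (Z t u))) ` ball 0 1 \<subseteq> D - K" by auto
    qed
  qed
  then show ?thesis by (simp add: g_def Zl)
qed

theorem corollary1p3:
  fixes D :: "(complex ^ 'n::{finite,linorder}) set"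
  assumes "CARD('n) \<ge> 2"
    and "C2_strongly_pseudoconvex_domain D"
  shows "\<not> (\<exists>E :: nat \<Rightarrow> (complex ^ 'n::_) set.
            incseq E \<and>
            (\<forall>j. open (E j) \<and> biholomorphic (E j) (symmetrized_polydisc :: (complex ^ 'n::_) set)) \<and>
            D = (\<Union>j. E j))"
proof
  assume "\<exists>E :: nat \<Rightarrow> (complex ^ 'n::_) set.
            incseq E \<and>
            (\<forall>j. open (E j) \<and> biholomorphic (E j) (symmetrized_polydisc :: (complex ^ 'n::_) set)) \<and>
            D = (\<Union>j. E j)"
  then obtain E :: "nat \<Rightarrow> (complex ^ 'n::_) set" where E: "incseq E" "\<And>j. open (E j)"
    and bih: "\<And>j. biholomorphic (E j) (symmetrized_polydisc :: (complex ^ 'n::_) set)"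
    and DE: "D = (\<Union>j. E j)" by blast
  have D: "open D" "connected D" "D \<noteq> {}"
    using assms(2) by (auto simp: C2_strongly_pseudoconvex_domain_def)
  define N where "N = real (CARD('n))"
  have N: "N \<ge> 2" using assms(1) by (simp add: N_def)
  obtain q where q: "q \<in> D" using D(3) by blast
  obtain e' where e': "e' > 0" "cball q e' \<subseteq> D"
    using open_contains_cball[THEN iffD1, OF D(1)] q by metis
  define e where "e = e' / 2"
  have e: "0 < e" "e < e'" using e' by (simp_all add: e_def)
  obtain J1 where J1: "\<And>j. j \<ge> J1 \<Longrightarrow> cball q e' \<subseteq> E j"
    using compact_subset_incseq[OF E compact_cball] e'(2) DE by metis
  \<comment> \<open>Changing up to \<open>N\<close> coordinates, each by a step that costs at most
    \<delta>, and summing over the \<open>N\<close> components of the image gives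
    \<open>N * (N * \<delta>)\<close>. This is made half of the displacement
    \<open>e * (1/2) ^ CARD('n)\<close> that the Schwarz lemma will demand.\<close>
  define \<delta> where "\<delta> = e / (2 * 2 ^ CARD('n) * N\<^sup>2)"
  have \<delta>: "\<delta> > 0" "N * (N * \<delta>) = e / 2 * (1/2) ^ CARD('n)"
    using e N by (simp_all add: \<delta>_def power2_eq_square power_one_over field_simps)
  obtain K where K: "compact K" "K \<subseteq> D"
    and disc: "\<And>(f :: complex \<Rightarrow> complex ^ 'n::_) x y i. (\<And>i. (\<lambda>z. f z $ i) holomorphic_on ball 0 1) \<Longrightarrow>
       f ` ball 0 1 \<subseteq> D - K \<Longrightarrow> x \<in> cball 0 (1/2) \<Longrightarrow> y \<in> cball 0 (1/2) \<Longrightarrow> cmod (f x $ i - f y $ i) \<le> \<delta>"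
    using small_discs_near_frontier[OF assms(2) \<delta>(1)] by metis
  obtain c J2 where c: "c > 0" and J2: "\<And>j h w. j \<ge> J2 \<Longrightarrow> disc_function_on h (E j) \<Longrightarrow> w \<in> K \<Longrightarrow>
       c * (1 - (cmod (h w))\<^sup>2) \<le> 1 - (cmod (h q))\<^sup>2"
    using disc_functions_Harnack_exhaustion[OF E D(2) DE K q] by metis
  \<comment> \<open>The bound \<delta>, the compact set \<open>K\<close> and the Harnack constant
    \<open>c\<close> are fixed before \<open>j\<close>, so one sufficiently late domain
    suffices.\<close>
  define j where "j = max J1 J2"
  have "J2 \<le> j" by (simp add: j_def)
  have qE: "cball q e' \<subseteq> E j" using J1 by (simp add: j_def)
  obtain F G where F: "holomorphic_map_on F (E j)" "F ` E j = symmetrized_polydisc"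
    and G: "holomorphic_map_on G (symmetrized_polydisc :: (complex ^ 'n::_) set)" "G ` symmetrized_polydisc = E j"
    and GF: "\<And>w. w \<in> E j \<Longrightarrow> G (F w) = w" and FG: "\<And>s. s \<in> symmetrized_polydisc \<Longrightarrow> F (G s) = s"
    using bih[of j] unfolding biholomorphic_def by metis
  have "q \<in> E j" using qE e' by auto
  then obtain a where a: "a \<in> unit_polydisc" "F q = symmetrization a"
    using F(2) by (auto simp: symmetrized_polydisc_def)
  have a1: "cmod (a $ k) < 1" for k using a(1) by (simp add: unit_polydisc_def)
  have FE: "F ` E j \<subseteq> symmetrized_polydisc" using F(2) by simp
  obtain r where r: "r < 1"
    and esc: "\<And>w z l. w \<in> K \<Longrightarrow> F w = symmetrization z \<Longrightarrow> z \<in> unit_polydisc \<Longrightarrow> cmod (z $ l) < r"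
    using polydisc_image_escapes[OF F(1) FE E(2) a c J2[OF \<open>J2 \<le> j\<close>]] by metis
  have esc': "cmod (z $ l) < r" if "z \<in> unit_polydisc" "G (symmetrization z) \<in> K" for z l
    using esc[OF that(2) _ that(1)] FG that(1) by (simp add: symmetrized_polydisc_def)
  obtain k0 :: 'n where True by blast
  \<comment> \<open>\<mu> and \<nu> are mutually inverse disc automorphisms; \<nu> sends
    \<open>a $ k0\<close> to 0, so the modulus of \<nu> measures pseudohyperbolic distance from
    \<open>a $ k0\<close>.\<close>
  define \<mu> where "\<mu> = Moebius_function 0 (- (a $ k0))"
  define \<nu> where "\<nu> = Moebius_function 0 (a $ k0)"
  have \<mu>: "\<mu> holomorphic_on ball 0 1" "\<And>t. cmod t < 1 \<Longrightarrow> cmod (\<mu> t) < 1"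
    using a1[of k0] by (simp_all add: \<mu>_def Moebius_function_holomorphic Moebius_function_norm_lt_1)
  have \<mu>\<nu>: "\<mu> (\<nu> t) = t" "\<nu> (\<mu> t) = t" if "cmod t < 1" for t
    using a1[of k0] that Moebius_function_compose[of "- (a $ k0)" "a $ k0"]
      Moebius_function_compose[of "a $ k0" "- (a $ k0)"] by (simp_all add: \<mu>_def \<nu>_def)
  \<comment> \<open>Coordinates closer than 1/2 to \<open>a $ k0\<close> are moved to distance
    exactly 1/2, and the others stay. Old and new values of a moved coordinate have parameters in
    the closed half disc, where \<open>polydisc_coordinate_step\<close> applies.\<close>
  define b where "b k = (if cmod (\<nu> (a $ k)) < 1/2 then \<mu> (1/2) else a $ k)" for k
  have b1: "cmod (b k) < 1" for k using a1 \<mu>(2) by (simp add: b_def)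
  have b2: "cmod (\<nu> (b k)) \<ge> 1/2" for k by (simp add: b_def \<mu>\<nu>)
  define f where "f z = G (symmetrization z)" for z
  have GD: "G ` symmetrized_polydisc \<subseteq> D" using G(2) DE by auto
  \<comment> \<open>The coordinates are replaced one at a time, each at a cost of at most
    \<delta>.\<close>
  have chain: "cmod (f (\<chi> k. if k \<in> A then b k else a $ k) $ i - f a $ i) \<le> card A * \<delta>" for A i
    using finite[of A]
  proof induction
    case empty
    then show ?case by simp
  next
    case (insert k A)
    define z where "z = (\<chi> k. if k \<in> A then b k else a $ k)"
    define z' where "z' = (\<chi> k'. if k' \<in> insert k A then b k' else a $ k')"
    have z: "z \<in> unit_polydisc" using a1 b1 by (simp add: z_def unit_polydisc_def)
    have "cmod (f z' $ i - f z $ i) \<le> \<delta>"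
    proof (cases "cmod (\<nu> (a $ k)) < 1/2")
      case True
      have "z' = (\<chi> m. if m = k then \<mu> (1/2) else z $ m)"
        using True by (auto simp: z'_def z_def vec_eq_iff b_def)
      moreover have "z = (\<chi> m. if m = k then \<mu> (\<nu> (a $ k)) else z $ m)"
        using insert.hyps by (auto simp: z_def vec_eq_iff \<mu>\<nu> a1)
      moreover have "cmod (f (\<chi> m. if m = k then \<mu> (1/2) else z $ m) $ i
          - f (\<chi> m. if m = k then \<mu> (\<nu> (a $ k)) else z $ m) $ i) \<le> \<delta>"
        unfolding f_def using True
        by (intro polydisc_coordinate_step[OF G(1) GD disc r esc' \<mu> assms(1) z]) auto
      ultimately show ?thesis by metis
    next
      case False
      then have "z' = z" using insert.hyps by (auto simp: z'_def z_def vec_eq_iff b_def)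
      then show ?thesis using \<delta> by simp
    qed
    moreover have "cmod (f z $ i - f a $ i) \<le> card A * \<delta>" using insert.IH by (simp add: z_def)
    ultimately have "cmod (f z' $ i - f a $ i) \<le> \<delta> + card A * \<delta>"
      using norm_triangle_ineq[of "f z' $ i - f z $ i" "f z $ i - f a $ i"] by simp
    also have "\<dots> = card (insert k A) * \<delta>" using insert.hyps by (simp add: algebra_simps)
    finally show ?case by (simp add: z'_def)
  qed
  define w where "w = f (vec_lambda b)"
  have fa: "f a = q" using GF \<open>q \<in> E j\<close> a(2) by (metis f_def)
  have "cmod ((w - q) $ i) \<le> N * \<delta>" for i
    using chain[of UNIV i] by (simp add: w_def fa N_def)
  then have "(\<Sum>i\<in>UNIV. cmod ((w - q) $ i)) \<le> (\<Sum>i\<in>(UNIV :: 'n set). N * \<delta>)" by (intro sum_mono)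
  then have "(\<Sum>i\<in>UNIV. cmod ((w - q) $ i)) \<le> N * (N * \<delta>)" by (simp add: N_def)
  moreover have "norm (w - q) \<le> (\<Sum>i\<in>UNIV. cmod ((w - q) $ i))"
    unfolding norm_vec_def by (rule L2_set_le_sum) simp
  ultimately have wq: "dist q w \<le> e / 2 * (1/2) ^ CARD('n)"
    by (simp add: \<delta>(2) dist_norm norm_minus_commute)
  also have "\<dots> \<le> e / 2 * 1" using e by (intro mult_left_mono power_le_one) auto
  also have "\<dots> < e" using e by simp
  finally have wqe: "dist q w < e" .
  \<comment> \<open>Every factor of \<open>h w\<close> has modulus at least \<open>1/2\<close>, whereas \<open>h\<close> vanishes at \<open>q\<close>.\<close>
  define h where "h w = blaschke (a $ k0) (F w)" for w
  have h: "disc_function_on h (E j)"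
    unfolding h_def by (rule disc_function_on_blaschke[OF F(1) FE E(2) a1])
  have "Moebius_function 0 (a $ k0) (a $ k0) = 0" by (simp add: Moebius_function_eq_zero)
  then have hq: "h q = 0" unfolding h_def a(2) blaschke_symmetrization by (intro prod_zero) auto
  have "vec_lambda b \<in> unit_polydisc" using b1 by (simp add: unit_polydisc_def)
  then have "F w = symmetrization (vec_lambda b)"
    using FG by (simp add: w_def f_def symmetrized_polydisc_def)
  then have "cmod (h w) = (\<Prod>k\<in>UNIV. cmod (\<nu> (b k)))"
    by (simp add: h_def norm_blaschke_symmetrization \<nu>_def)
  also have "\<dots> \<ge> (\<Prod>k\<in>(UNIV :: 'n set). 1/2)" using b2 by (intro prod_mono) auto
  finally have "cmod (h w) \<ge> (1/2) ^ CARD('n)" by simp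
  then have "(1/2) ^ CARD('n) * e \<le> cmod (h w) * e" using e by (intro mult_right_mono) auto
  also have "\<dots> \<le> dist q w"
    using disc_function_on_Schwarz[OF h _ hq wqe e(2)] qE ball_subset_cball by blast
  finally have "(1/2) ^ CARD('n) * e \<le> e / 2 * (1/2) ^ CARD('n)" using wq by linarith
  then show False using e by simp
qed

end
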